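(* Let $(X, \|\cdot\|)$ be a real normed space of dimension at least $2$, and let $\lambda \in [0, 1]$. The following conditions are equivalent: (i) $\perp_{B}\subseteq \perp_{\rho_{\lambda}}$. (ii) $\perp_{B} = \perp_{\rho_{\lambda}}$. (iii) $X$ is smooth.
   Context: For a real normed space $X$ and $x,y\in X$, the norm derivatives are $\rho_{-}(x,y):=\|x\|\lim_{t\to 0^{-}}\frac{\|x+ty\|-\|x\|}{t}$ and $\rho_{+}(x,y):=\|x\|\lim_{t\to 0^{+}}\frac{\|x+ty\|-\|x\|}{t}$ (the limits exist by convexity of the norm). For $\lambda\in[0,1]$, $\rho_{\lambda}(x, y) := \lambda\rho_-(x,y) + (1 - \lambda)\rho_+(x,y)$, and $x\perp_{\rho_{\lambda}}y$ means $\rho_{\lambda}(x,y)=0$. Birkhoff--James orthogonality: $x\perp_B y$ means $\|x+\alpha y\|\ge\|x\|$ for all $\alpha\in\mathbb{R}$. Inclusions and equalities are between relations viewed as subsets of $X\times X$. A support functional at a nonzero $x\in X$ is a norm-one linear functional $F_x$ on $X$ with $F_x(x)=\|x\|$; $X$ is smooth at $x$ if there is a unique support functional at $x$, and $X$ is smooth if it is smooth at every nonzero $x\in X$. *)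

theory Defs
  imports "HOL-Analysis.Analysis"
begin

text \<open>
  Norm derivatives. The one-sided limits always exist, since the norm is convex; hence
  \<^const>\<open>Lim\<close> never takes its unspecified value here. At \<open>x = 0\<close> both derivatives are \<open>0\<close>.
\<close>

definition rho_minus :: "'a::real_normed_vector \<Rightarrow> 'a \<Rightarrow> real" where
  "rho_minus x y = norm x * Lim (at_left 0) (\<lambda>t. (norm (x + t *\<^sub>R y) - norm x) / t)"

definition rho_plus :: "'a::real_normed_vector \<Rightarrow> 'a \<Rightarrow> real" where
  "rho_plus x y = norm x * Lim (at_right 0) (\<lambda>t. (norm (x + t *\<^sub>R y) - norm x) / t)"

definition rho :: "real \<Rightarrow> 'a::real_normed_vector \<Rightarrow> 'a \<Rightarrow> real" where
  "rho lam x y = lam * rho_minus x y + (1 - lam) * rho_plus x y"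

definition rho_orth :: "real \<Rightarrow> ('a::real_normed_vector \<times> 'a) set" where
  "rho_orth lam = {(x, y). rho lam x y = 0}"

definition birkhoff_orth :: "('a::real_normed_vector \<times> 'a) set" where
  "birkhoff_orth = {(x, y). \<forall>\<alpha>::real. norm (x + \<alpha> *\<^sub>R y) \<ge> norm x}"

text \<open>
  The norm on \<^typ>\<open>'a::real_normed_vector \<Rightarrow>\<^sub>L real\<close> is the operator norm.
\<close>

definition support_functional :: "'a::real_normed_vector \<Rightarrow> ('a \<Rightarrow>\<^sub>L real) \<Rightarrow> bool" where
  "support_functional x F \<longleftrightarrow> norm F = 1 \<and> blinfun_apply F x = norm x"

definition smooth_at :: "'a::real_normed_vector \<Rightarrow> bool" where
  "smooth_at x \<longleftrightarrow> (\<exists>!F. support_functional x F)"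

definition smooth_space :: "'a::real_normed_vector itself \<Rightarrow> bool" where
  "smooth_space _ \<longleftrightarrow> (\<forall>x::'a. x \<noteq> 0 \<longrightarrow> smooth_at x)"

text \<open>
  Dimension at least 2, infinite dimension included. The condition \<open>dim UNIV \<ge> 2\<close> would not do,
  because \<^const>\<open>dim\<close> is \<open>0\<close> on spaces without a finite basis.
\<close>

definition dimension_ge_2 :: "'a::real_vector itself \<Rightarrow> bool" where
  "dimension_ge_2 _ \<longleftrightarrow> (\<exists>B::'a set. independent B \<and> card B = 2)"

end

theory Submission
  imports Defs
begin

text \<open>
  Write \<open>p\<^sub>x(y)\<close> for the right derivative of \<open>t \<mapsto> \<parallel>x + ty\<parallel>\<close> at \<open>0\<close>. By convexity the difference
  quotient increases with \<open>t > 0\<close>, so \<open>p\<^sub>x(y)\<close> is an infimum; it is sublinear in \<open>y\<close>, and the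
  left derivative is \<open>- p\<^sub>x(-y)\<close>, which is at most \<open>p\<^sub>x(y)\<close>. Two descriptions in terms of \<open>p\<^sub>x\<close>
  carry the proof:

  \<^item> \<open>x\<close> is Birkhoff--James orthogonal to \<open>y\<close> iff \<open>- p\<^sub>x(-y) \<le> 0 \<le> p\<^sub>x(y)\<close>
    (lemma \<open>birkhoff_orth_iff\<close>);
  \<^item> the support functionals at \<open>x \<noteq> 0\<close> are the linear functionals below \<open>p\<^sub>x\<close>
    (lemmas \<open>support_functional_le_norm_deriv\<close> and \<open>support_functionalI\<close>).

  By the Hahn--Banach theorem every value \<open>p\<^sub>x(y)\<close> is attained by a linear functional below
  \<open>p\<^sub>x\<close>. Hence \<open>x\<close> is a point of smoothness iff \<open>p\<^sub>x\<close> is odd, that is, iff the two one-sided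
  derivatives agree (lemma \<open>smooth_at_iff\<close>).

  If the space is smooth and \<open>x \<noteq> 0\<close>, then \<open>\<rho>\<^sub>\<lambda>(x,y) = \<parallel>x\<parallel> p\<^sub>x(y)\<close>, and both orthogonality
  relations say that \<open>p\<^sub>x(y) = 0\<close>; the vector \<open>x = 0\<close> is orthogonal to everything in both senses.
  Conversely, let \<open>m \<le> p\<close> be the left and right derivative of the norm at \<open>x \<noteq> 0\<close> in
  direction \<open>y\<close>. Adding a multiple of \<open>x\<close> to \<open>y\<close> shifts both by the same number, so \<open>y\<close> can be moved
  to a direction with derivatives \<open>0\<close> and \<open>p - m\<close>, or to one with derivatives \<open>m - p\<close> and \<open>0\<close>. Both
  directions are Birkhoff--James orthogonal to \<open>x\<close>. If they are also \<open>\<rho>\<^sub>\<lambda>\<close>-orthogonal, then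
  \<open>(1 - \<lambda>) (p - m) = 0\<close> and \<open>\<lambda> (m - p) = 0\<close>, whence \<open>p = m\<close>.
\<close>

section \<open>Sublinear functionals and the Hahn--Banach theorem\<close>

definition sublinear :: "('a::real_vector \<Rightarrow> real) \<Rightarrow> bool" where
  "sublinear p \<longleftrightarrow> (\<forall>y z. p (y + z) \<le> p y + p z) \<and> (\<forall>c y. 0 \<le> c \<longrightarrow> p (c *\<^sub>R y) = c * p y)"

lemma sublinear_add: "sublinear p \<Longrightarrow> p (y + z) \<le> p y + p z"
  by (simp add: sublinear_def)

lemma sublinear_scale: "sublinear p \<Longrightarrow> 0 \<le> c \<Longrightarrow> p (c *\<^sub>R y) = c * p y"
  by (simp add: sublinear_def)

lemma sublinear_zero: "sublinear p \<Longrightarrow> p 0 = 0"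
  using sublinear_scale[of p 0 0] by simp

lemma sublinear_minus: "sublinear p \<Longrightarrow> - p (- y) \<le> p y"
  using sublinear_add[of p y "- y"] sublinear_zero[of p] by simp

text \<open>
  For a positive factor one inequality is enough, because the inverse factor gives the other one.
\<close>

lemma sublinearI:
  assumes add: "\<And>y z. p (y + z) \<le> p y + p z" and zero: "p 0 = 0"
    and scale: "\<And>c y. 0 < c \<Longrightarrow> p (c *\<^sub>R y) \<le> c * p y"
  shows "sublinear p"
proof -
  have "p (c *\<^sub>R y) = c * p y" if "0 \<le> c" for c y
  proof (cases "c = 0")
    case False
    with that have c: "0 < c" by simp
    then have "p y \<le> inverse c * p (c *\<^sub>R y)"
      using scale[of "inverse c" "c *\<^sub>R y"] by simp
    then have "c * p y \<le> p (c *\<^sub>R y)"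
      using c by (simp add: field_simps)
    with scale[OF c, of y] show ?thesis by simp
  qed (simp add: zero)
  with add show ?thesis by (simp add: sublinear_def)
qed

lemma linear_if_sublinear_odd:
  assumes p: "sublinear p" and odd: "\<And>y. p (- y) = - p y"
  shows "linear p"
proof (rule linearI)
  fix y z :: 'a and c :: real
  have "p (- y + - z) \<le> p (- y) + p (- z)"
    by (rule sublinear_add[OF p])
  then have "p y + p z \<le> p (y + z)"
    using odd[of y] odd[of z] odd[of "y + z"] by simp
  with sublinear_add[OF p, of y z] show "p (y + z) = p y + p z"
    by simp
  show "p (c *\<^sub>R y) = c *\<^sub>R p y"
  proof (cases "0 \<le> c")
    case False
    then show ?thesis
      using sublinear_scale[OF p, of "- c" y] odd[of "c *\<^sub>R y"] by simp
  qed (simp add: sublinear_scale[OF p])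
qed

text \<open>
  The largest sublinear functional below \<open>p\<close> whose value at \<open>- y\<close> is at most \<open>- p y\<close>. Passing from
  \<open>p\<close> to it makes \<open>p\<close> linear along the line through \<open>y\<close>.
\<close>

definition flatten :: "('a::real_vector \<Rightarrow> real) \<Rightarrow> 'a \<Rightarrow> 'a \<Rightarrow> real" where
  "flatten p y z = (INF t\<in>{0..}. p (z + t *\<^sub>R y) - t * p y)"

lemma flatten_le:
  assumes p: "sublinear p" and "0 \<le> t"
  shows "flatten p y z \<le> p (z + t *\<^sub>R y) - t * p y"
  unfolding flatten_def
proof (rule cINF_lower)
  have "- p (- z) \<le> p (z + s *\<^sub>R y) - s * p y" if "0 \<le> s" for s
    using sublinear_add[OF p, of "z + s *\<^sub>R y" "- z"] sublinear_scale[OF p that, of y] by simp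
  then show "bdd_below ((\<lambda>s. p (z + s *\<^sub>R y) - s * p y) ` {0..})"
    by (intro bdd_belowI2[where m = "- p (- z)"]) simp
qed (simp add: \<open>0 \<le> t\<close>)

lemma flatten_greatest:
  assumes "\<And>t. 0 \<le> t \<Longrightarrow> a \<le> p (z + t *\<^sub>R y) - t * p y"
  shows "a \<le> flatten p y z"
  unfolding flatten_def by (rule cINF_greatest) (auto intro: assms)

lemma flatten_le_self: "sublinear p \<Longrightarrow> flatten p y z \<le> p z"
  using flatten_le[of p 0 y z] by simp

lemma flatten_minus_le: "sublinear p \<Longrightarrow> flatten p y (- y) \<le> - p y"
  using flatten_le[of p 1 y "- y"] sublinear_zero[of p] by simp

lemma sublinear_flatten:
  assumes p: "sublinear p"
  shows "sublinear (flatten p y)"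
proof (rule sublinearI)
  fix z w
  have "flatten p y (z + w) \<le> (p (z + s *\<^sub>R y) - s * p y) + (p (w + t *\<^sub>R y) - t * p y)"
    if "0 \<le> s" "0 \<le> t" for s t
  proof -
    have "flatten p y (z + w) \<le> p (z + w + (s + t) *\<^sub>R y) - (s + t) * p y"
      using that by (intro flatten_le p) simp
    also have "z + w + (s + t) *\<^sub>R y = (z + s *\<^sub>R y) + (w + t *\<^sub>R y)"
      by (simp add: algebra_simps)
    finally show ?thesis
      using sublinear_add[OF p, of "z + s *\<^sub>R y" "w + t *\<^sub>R y"] by (simp add: algebra_simps)
  qed
  then have "flatten p y (z + w) - (p (w + t *\<^sub>R y) - t * p y) \<le> flatten p y z" if "0 \<le> t" for t
    using that by (intro flatten_greatest) (simp add: diff_le_eq)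
  then have "flatten p y (z + w) - flatten p y z \<le> flatten p y w"
    by (intro flatten_greatest) (simp add: algebra_simps)
  then show "flatten p y (z + w) \<le> flatten p y z + flatten p y w"
    by simp
next
  have "0 \<le> flatten p y 0"
    by (intro flatten_greatest) (simp add: sublinear_scale[OF p])
  then show "flatten p y 0 = 0"
    using flatten_le_self[OF p, of y 0] sublinear_zero[OF p] by simp
next
  fix c :: real and z
  assume c: "0 < c"
  have "flatten p y (c *\<^sub>R z) / c \<le> flatten p y z"
  proof (rule flatten_greatest)
    fix t :: real
    assume "0 \<le> t"
    with c have "flatten p y (c *\<^sub>R z) \<le> p (c *\<^sub>R z + (c * t) *\<^sub>R y) - c * t * p y"
      by (intro flatten_le p) simp
    also have "c *\<^sub>R z + (c * t) *\<^sub>R y = c *\<^sub>R (z + t *\<^sub>R y)"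
      by (simp add: algebra_simps)
    also have "p \<dots> = c * p (z + t *\<^sub>R y)"
      using c by (simp add: sublinear_scale[OF p])
    finally show "flatten p y (c *\<^sub>R z) / c \<le> p (z + t *\<^sub>R y) - t * p y"
      using c by (simp add: field_simps)
  qed
  with c show "flatten p y (c *\<^sub>R z) \<le> c * flatten p y z"
    by (simp add: field_simps)
qed

text \<open>
  A sublinear \<open>q \<le> p\<close> satisfies \<open>- p (- z) \<le> - q (- z) \<le> q z\<close>, so a family of them is bounded below
  pointwise. Subadditivity of the infimum is where the family has to be a chain: the values at \<open>y\<close>
  and at \<open>z\<close> have to be compared with those of a single member.
\<close>

lemma sublinear_INF_chain:
  assumes "C \<noteq> {}" and sub: "\<And>q. q \<in> C \<Longrightarrow> sublinear q" and le: "\<And>q. q \<in> C \<Longrightarrow> q \<le> p"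
    and chain: "\<And>q r. q \<in> C \<Longrightarrow> r \<in> C \<Longrightarrow> q \<le> r \<or> r \<le> q"
  shows "sublinear (\<lambda>z. INF q\<in>C. q z)" and "\<And>q. q \<in> C \<Longrightarrow> (\<lambda>z. INF q\<in>C. q z) \<le> q"
proof -
  have bdd: "bdd_below ((\<lambda>q. q z) ` C)" for z
  proof (rule bdd_belowI2[where m = "- p (- z)"])
    fix q
    assume "q \<in> C"
    then show "- p (- z) \<le> q z"
      using sublinear_minus[OF sub, of q z] le[of q] by (auto simp: le_fun_def intro: order_trans[rotated])
  qed
  have lower: "(INF q\<in>C. q z) \<le> q z" if "q \<in> C" for q z
    using bdd that by (rule cINF_lower)
  then show "\<And>q. q \<in> C \<Longrightarrow> (\<lambda>z. INF q\<in>C. q z) \<le> q"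
    by (simp add: le_fun_def)
  show "sublinear (\<lambda>z. INF q\<in>C. q z)"
  proof (rule sublinearI)
    fix y z
    have sum: "(INF q\<in>C. q (y + z)) \<le> q y + r z" if q: "q \<in> C" and r: "r \<in> C" for q r
    proof -
      obtain s where s: "s \<in> C" "s \<le> q" "s \<le> r"
        using chain[OF q r] q r by blast
      have "(INF q\<in>C. q (y + z)) \<le> s (y + z)"
        by (rule lower[OF s(1)])
      also have "\<dots> \<le> s y + s z"
        by (rule sublinear_add[OF sub[OF s(1)]])
      also have "\<dots> \<le> q y + r z"
        using s by (intro add_mono) (auto simp: le_fun_def)
      finally show ?thesis .
    qed
    have "(INF q\<in>C. q (y + z)) - r z \<le> (INF q\<in>C. q y)" if "r \<in> C" for r
      using sum that by (intro cINF_greatest \<open>C \<noteq> {}\<close>) (simp add: diff_le_eq)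
    then have "(INF q\<in>C. q (y + z)) - (INF q\<in>C. q y) \<le> (INF q\<in>C. q z)"
      by (intro cINF_greatest \<open>C \<noteq> {}\<close>) (simp add: algebra_simps)
    then show "(INF q\<in>C. q (y + z)) \<le> (INF q\<in>C. q y) + (INF q\<in>C. q z)"
      by simp
  next
    have "(INF q\<in>C. q 0) = (INF q\<in>C. 0)"
      by (rule INF_cong) (simp_all add: sublinear_zero[OF sub])
    with \<open>C \<noteq> {}\<close> show "(INF q\<in>C. q 0) = 0" by simp
  next
    fix c :: real and z
    assume c: "0 < c"
    have "(INF q\<in>C. q (c *\<^sub>R z)) / c \<le> (INF q\<in>C. q z)"
    proof (rule cINF_greatest[OF \<open>C \<noteq> {}\<close>])
      fix q
      assume q: "q \<in> C"
      show "(INF q\<in>C. q (c *\<^sub>R z)) / c \<le> q z"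
        using lower[OF q, of "c *\<^sub>R z"] sublinear_scale[OF sub[OF q], of c z] c
        by (simp add: field_simps)
    qed
    with c show "(INF q\<in>C. q (c *\<^sub>R z)) \<le> c * (INF q\<in>C. q z)"
      by (simp add: field_simps)
  qed
qed

text \<open>
  Zorn's lemma yields a minimal sublinear functional below \<open>p\<close>. It coincides with each of its
  flattenings, hence is odd, hence linear.
\<close>

lemma ex_linear_le_sublinear:
  fixes p :: "'a::real_vector \<Rightarrow> real"
  assumes p: "sublinear p"
  obtains f where "linear f" and "f \<le> p"
proof -
  define S where "S = {q. sublinear q \<and> q \<le> p}"
  have "\<exists>m\<in>S. \<forall>a\<in>S. a \<le> m \<longrightarrow> a = m"
  proof (rule predicate_Zorn)
    show "partial_order_on S (relation_of (\<lambda>q r. r \<le> q) S)"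
      by (rule partial_order_on_relation_ofI) auto
  next
    fix C
    assume "C \<in> Chains (relation_of (\<lambda>q r. r \<le> q) S)"
    then have C: "\<And>q. q \<in> C \<Longrightarrow> q \<in> S" and chain: "\<And>q r. q \<in> C \<Longrightarrow> r \<in> C \<Longrightarrow> q \<le> r \<or> r \<le> q"
      by (auto simp: Chains_def relation_of_def)
    show "\<exists>u\<in>S. \<forall>q\<in>C. u \<le> q"
    proof (cases "C = {}")
      case True
      with p show ?thesis by (auto simp: S_def)
    next
      case False
      define u where "u = (\<lambda>z. INF q\<in>C. q z)"
      have "sublinear u" and u: "\<And>q. q \<in> C \<Longrightarrow> u \<le> q"
        using sublinear_INF_chain[OF False, of p] C chain unfolding u_def S_def by blast+
      moreover obtain q where "q \<in> C" using False by blast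
      ultimately have "u \<in> S"
        using C[of q] u[of q] by (auto simp: S_def intro: order_trans)
      with u show ?thesis by blast
    qed
  qed
  then obtain m where m: "sublinear m" "m \<le> p"
    and min: "\<And>q. sublinear q \<Longrightarrow> q \<le> p \<Longrightarrow> q \<le> m \<Longrightarrow> q = m"
    by (auto simp: S_def)
  have "m (- y) = - m y" for y
  proof -
    have "flatten m y \<le> m"
      by (simp add: le_fun_def flatten_le_self[OF m(1)])
    then have "flatten m y = m"
      using min[OF sublinear_flatten[OF m(1)]] m(2) by (meson order_trans)
    with flatten_minus_le[OF m(1), of y] have "m (- y) \<le> - m y"
      by simp
    with sublinear_minus[OF m(1), of y] show ?thesis by simp
  qed
  then have "linear m"
    by (rule linear_if_sublinear_odd[OF m(1)])
  with m(2) show thesis by (rule that[rotated])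
qed

text \<open>
  A linear functional below \<open>flatten p y\<close> is at most \<open>- p y\<close> at \<open>- y\<close>, hence at least \<open>p y\<close> at \<open>y\<close>.
\<close>

theorem hahn_banach_attained:
  fixes p :: "'a::real_vector \<Rightarrow> real"
  assumes p: "sublinear p"
  obtains f where "linear f" and "\<And>z. f z \<le> p z" and "f y = p y"
proof -
  obtain f where f: "linear f" "f \<le> flatten p y"
    using ex_linear_le_sublinear[OF sublinear_flatten[OF p]] by blast
  have le: "f z \<le> p z" for z
    using f(2) flatten_le_self[OF p, of y z] by (meson le_funD order_trans)
  have "f (- y) \<le> - p y"
    using f(2) flatten_minus_le[OF p, of y] by (meson le_funD order_trans)
  then have "f y = p y"
    using le[of y] linear_neg[OF f(1), of y] by simp
  with f(1) le show thesis by (rule that)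
qed

section \<open>The one-sided derivative of the norm\<close>

text \<open>
  The right derivative of the norm at \<open>x\<close> in direction \<open>y\<close>, as an infimum instead of a limit:
  the order properties below can then be read off for each \<open>t\<close> separately.
\<close>

definition norm_deriv :: "'a::real_normed_vector \<Rightarrow> 'a \<Rightarrow> real" where
  "norm_deriv x y = (INF t\<in>{0<..}. (norm (x + t *\<^sub>R y) - norm x) / t)"

lemma norm_quotient_ge:
  fixes x y :: "'a::real_normed_vector"
  assumes "0 < t"
  shows "- norm y \<le> (norm (x + t *\<^sub>R y) - norm x) / t"
proof -
  have "norm x \<le> norm (x + t *\<^sub>R y) + norm (t *\<^sub>R y)"
    using norm_triangle_ineq4[of "x + t *\<^sub>R y" "t *\<^sub>R y"] by simp
  with assms show ?thesis by (simp add: field_simps)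
qed

lemma norm_deriv_le:
  assumes "0 < t"
  shows "norm_deriv x y \<le> (norm (x + t *\<^sub>R y) - norm x) / t"
  unfolding norm_deriv_def
  by (rule cINF_lower) (use assms norm_quotient_ge in \<open>auto intro!: bdd_belowI2[where m = "- norm y"]\<close>)

lemma norm_deriv_greatest:
  assumes "\<And>t. 0 < t \<Longrightarrow> a \<le> (norm (x + t *\<^sub>R y) - norm x) / t"
  shows "a \<le> norm_deriv x y"
  unfolding norm_deriv_def by (rule cINF_greatest) (auto intro: assms gt_ex)

lemma norm_deriv_nonneg_iff: "0 \<le> norm_deriv x y \<longleftrightarrow> (\<forall>t>0. norm x \<le> norm (x + t *\<^sub>R y))"
proof
  assume "0 \<le> norm_deriv x y"
  then have "0 \<le> (norm (x + t *\<^sub>R y) - norm x) / t" if "0 < t" for t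
    using norm_deriv_le[OF that, of x y] by simp
  then show "\<forall>t>0. norm x \<le> norm (x + t *\<^sub>R y)"
    by (simp add: zero_le_divide_iff)
qed (simp add: norm_deriv_greatest)

lemma norm_deriv_le_norm: "norm_deriv x y \<le> norm y"
  using norm_deriv_le[of 1 x y] norm_triangle_ineq[of x y] by simp

lemma norm_quotient_mono:
  fixes x y :: "'a::real_normed_vector"
  assumes s: "0 < s" and st: "s \<le> t"
  shows "(norm (x + s *\<^sub>R y) - norm x) / s \<le> (norm (x + t *\<^sub>R y) - norm x) / t"
proof -
  have t: "0 < t" using assms by simp
  \<comment> \<open>\<open>x + sy\<close> is the convex combination of \<open>x\<close> and \<open>x + ty\<close> with weight \<open>s/t\<close> on the latter.\<close>
  have "t *\<^sub>R (x + s *\<^sub>R y) = (t - s) *\<^sub>R x + s *\<^sub>R (x + t *\<^sub>R y)"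
    by (simp add: algebra_simps)
  then have "norm (t *\<^sub>R (x + s *\<^sub>R y)) \<le> norm ((t - s) *\<^sub>R x) + norm (s *\<^sub>R (x + t *\<^sub>R y))"
    by (metis norm_triangle_ineq)
  then have "t * norm (x + s *\<^sub>R y) \<le> (t - s) * norm x + s * norm (x + t *\<^sub>R y)"
    using assms t by simp
  then show ?thesis
    using s t by (simp add: field_simps)
qed

lemma tendsto_norm_deriv:
  "((\<lambda>t. (norm (x + t *\<^sub>R y) - norm x) / t) \<longlongrightarrow> norm_deriv x y) (at_right 0)"
proof (rule order_tendstoI)
  fix a
  assume "a < norm_deriv x y"
  then have "a < (norm (x + t *\<^sub>R y) - norm x) / t" if "0 < t" for t
    using norm_deriv_le[OF that, of x y] by simp
  then show "\<forall>\<^sub>F t in at_right 0. a < (norm (x + t *\<^sub>R y) - norm x) / t"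
    by (auto simp: eventually_at_filter)
next
  fix a
  assume a: "norm_deriv x y < a"
  obtain s where s: "0 < s" "(norm (x + s *\<^sub>R y) - norm x) / s < a"
    using norm_deriv_greatest[of a x y] a by (meson not_le)
  then have "(norm (x + t *\<^sub>R y) - norm x) / t < a" if "0 < t" "t < s" for t
    using norm_quotient_mono[of t s x y] that by simp
  then show "\<forall>\<^sub>F t in at_right 0. (norm (x + t *\<^sub>R y) - norm x) / t < a"
    using s(1) by (auto simp: eventually_at_right)
qed

lemma sublinear_norm_deriv: "sublinear (norm_deriv x)"
proof (rule sublinearI)
  fix y z
  have sum: "norm_deriv x (y + z) \<le>
      (norm (x + s *\<^sub>R y) - norm x) / s + (norm (x + t *\<^sub>R z) - norm x) / t"
    if "0 < s" "0 < t" for s t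
  proof -
    define r where "r = min s t"
    have r: "0 < r" "r \<le> s" "r \<le> t"
      using that by (auto simp: r_def)
    \<comment> \<open>The step for \<open>y + z\<close> is half as long: \<open>x + (r/2)(y + z)\<close> is the midpoint of \<open>x + ry\<close> and
      \<open>x + rz\<close>.\<close>
    have "2 *\<^sub>R (x + (r / 2) *\<^sub>R (y + z)) = (x + r *\<^sub>R y) + (x + r *\<^sub>R z)"
      by (simp add: algebra_simps scaleR_2)
    then have "norm (2 *\<^sub>R (x + (r / 2) *\<^sub>R (y + z))) \<le> norm (x + r *\<^sub>R y) + norm (x + r *\<^sub>R z)"
      by (metis norm_triangle_ineq)
    then have "2 * norm (x + (r / 2) *\<^sub>R (y + z)) \<le> norm (x + r *\<^sub>R y) + norm (x + r *\<^sub>R z)"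
      by (simp only: norm_scaleR abs_numeral)
    then have half: "2 * (norm (x + (r / 2) *\<^sub>R (y + z)) - norm x)
        \<le> (norm (x + r *\<^sub>R y) - norm x) + (norm (x + r *\<^sub>R z) - norm x)"
      by (simp del: scaleR_add_right)
    have "2 * (norm (x + (r / 2) *\<^sub>R (y + z)) - norm x) / r
        \<le> ((norm (x + r *\<^sub>R y) - norm x) + (norm (x + r *\<^sub>R z) - norm x)) / r"
      using r(1) by (intro divide_right_mono half) simp_all
    then have "(norm (x + (r / 2) *\<^sub>R (y + z)) - norm x) / (r / 2)
        \<le> (norm (x + r *\<^sub>R y) - norm x) / r + (norm (x + r *\<^sub>R z) - norm x) / r"
      by (simp only: add_divide_distrib divide_divide_eq_right mult.commute)
    then show ?thesis
      using norm_deriv_le[of "r / 2" x "y + z"] r norm_quotient_mono[of r s x y]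
        norm_quotient_mono[of r t x z] by simp
  qed
  have "norm_deriv x (y + z) - (norm (x + t *\<^sub>R z) - norm x) / t \<le> norm_deriv x y" if "0 < t" for t
    by (rule norm_deriv_greatest) (use sum[OF _ that] in \<open>simp only: diff_le_eq\<close>)
  then have "norm_deriv x (y + z) - norm_deriv x y \<le> norm_deriv x z"
    by (intro norm_deriv_greatest) (simp only: diff_le_eq add.commute)
  then show "norm_deriv x (y + z) \<le> norm_deriv x y + norm_deriv x z"
    by simp
next
  show "norm_deriv x 0 = 0"
    using norm_deriv_le_norm[of x 0] norm_deriv_nonneg_iff[of x 0] by simp
next
  fix c :: real and y
  assume c: "0 < c"
  have "norm_deriv x (c *\<^sub>R y) / c \<le> norm_deriv x y"
  proof (rule norm_deriv_greatest)
    fix t :: real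
    assume "0 < t"
    with c show "norm_deriv x (c *\<^sub>R y) / c \<le> (norm (x + t *\<^sub>R y) - norm x) / t"
      using norm_deriv_le[of "t / c" x "c *\<^sub>R y"] by (simp add: field_simps)
  qed
  with c show "norm_deriv x (c *\<^sub>R y) \<le> c * norm_deriv x y"
    by (simp add: field_simps)
qed

lemma norm_deriv_minus_self: "norm_deriv x (- x) \<le> - norm x"
  using norm_deriv_le[of 1 x "- x"] by simp

lemma norm_deriv_scaleR_self: "norm_deriv x (c *\<^sub>R x) \<le> c * norm x"
proof (cases "0 \<le> c")
  case True
  then show ?thesis
    using sublinear_scale[OF sublinear_norm_deriv True, of x x] norm_deriv_le_norm[of x x]
    by (simp add: mult_left_mono)
next
  case False
  then show ?thesis
    using sublinear_scale[OF sublinear_norm_deriv, of "- c" x "- x"]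
      mult_left_mono[OF norm_deriv_minus_self[of x], of "- c"] by simp
qed

text \<open>
  Along the line through \<open>x\<close> the derivative is linear; subadditivity, used for \<open>c\<close> and for \<open>- c\<close>,
  turns this into an exact translation rule.
\<close>

lemma norm_deriv_add_scaleR_self: "norm_deriv x (y + c *\<^sub>R x) = norm_deriv x y + c * norm x"
proof (rule antisym)
  show "norm_deriv x (y + c *\<^sub>R x) \<le> norm_deriv x y + c * norm x"
    using sublinear_add[OF sublinear_norm_deriv, of x y "c *\<^sub>R x"] norm_deriv_scaleR_self[of x c]
    by simp
  show "norm_deriv x y + c * norm x \<le> norm_deriv x (y + c *\<^sub>R x)"
    using sublinear_add[OF sublinear_norm_deriv, of x "y + c *\<^sub>R x" "(- c) *\<^sub>R x"]
      norm_deriv_scaleR_self[of x "- c"] by simp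
qed

section \<open>The two orthogonality relations\<close>

lemma rho_plus_eq: "rho_plus x y = norm x * norm_deriv x y"
  unfolding rho_plus_def by (simp add: tendsto_Lim[OF _ tendsto_norm_deriv])

text \<open>
  Reflecting \<open>t\<close> to \<open>- t\<close> turns a left-sided limit in direction \<open>y\<close> into a right-sided limit in
  direction \<open>- y\<close>.
\<close>

lemma rho_minus_eq: "rho_minus x y = - (norm x * norm_deriv x (- y))"
proof -
  have "((\<lambda>t. - ((norm (x + t *\<^sub>R (- y)) - norm x) / t)) \<longlongrightarrow> - norm_deriv x (- y)) (at_right 0)"
    by (intro tendsto_minus tendsto_norm_deriv)
  then have "((\<lambda>t. (norm (x + t *\<^sub>R y) - norm x) / t) \<longlongrightarrow> - norm_deriv x (- y)) (at_left 0)"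
    by (simp add: filterlim_at_left_to_right)
  then show ?thesis
    unfolding rho_minus_def using tendsto_Lim[OF trivial_limit_at_left_real] by fastforce
qed

lemma rho_eq: "rho lam x y = norm x * ((1 - lam) * norm_deriv x y - lam * norm_deriv x (- y))"
  by (simp add: rho_def rho_plus_eq rho_minus_eq algebra_simps)

lemma birkhoff_orth_iff:
  "(x, y) \<in> birkhoff_orth \<longleftrightarrow> 0 \<le> norm_deriv x y \<and> 0 \<le> norm_deriv x (- y)"
proof -
  have "(\<forall>a. norm x \<le> norm (x + a *\<^sub>R y)) \<longleftrightarrow>
      (\<forall>t>0. norm x \<le> norm (x + t *\<^sub>R y)) \<and> (\<forall>t>0. norm x \<le> norm (x + t *\<^sub>R (- y)))" (is "?L \<longleftrightarrow> ?R")
  proof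
    assume ?L
    then show ?R
      by (metis scaleR_minus_left scaleR_minus_right)
  next
    assume R: ?R
    show ?L
    proof
      fix a :: real
      show "norm x \<le> norm (x + a *\<^sub>R y)"
        using R[THEN conjunct1, rule_format, of a] R[THEN conjunct2, rule_format, of "- a"]
        by (cases a "0 :: real" rule: linorder_cases) auto
    qed
  qed
  then show ?thesis
    by (simp add: birkhoff_orth_def norm_deriv_nonneg_iff)
qed

section \<open>Support functionals and smoothness\<close>

lemma support_functional_le_norm_deriv:
  assumes "support_functional x F"
  shows "blinfun_apply F y \<le> norm_deriv x y"
proof (rule norm_deriv_greatest)
  fix t :: real
  assume t: "0 < t"
  have "blinfun_apply F (x + t *\<^sub>R y) \<le> norm (x + t *\<^sub>R y)"
    using norm_blinfun[of F "x + t *\<^sub>R y"] assms by (simp add: support_functional_def)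
  with t assms show "blinfun_apply F y \<le> (norm (x + t *\<^sub>R y) - norm x) / t"
    by (simp add: support_functional_def blinfun.add_right blinfun.scaleR_right field_simps)
qed

text \<open>
  Domination by \<open>norm_deriv x\<close> bounds the functional by the norm, and domination at \<open>- x\<close> forces the
  value \<open>norm x\<close> at \<open>x\<close>, which makes the norm of the functional equal to one.
\<close>

lemma support_functionalI:
  assumes "x \<noteq> 0" and f: "linear f" and le: "\<And>y. f y \<le> norm_deriv x y"
  obtains F where "support_functional x F" and "\<And>y. blinfun_apply F y = f y"
proof -
  have bound: "\<bar>f y\<bar> \<le> norm y" for y
    using le[of y] le[of "- y"] norm_deriv_le_norm[of x y] norm_deriv_le_norm[of x "- y"]
      linear_neg[OF f, of y] by simp
  then have "bounded_linear f"
    by (intro bounded_linear.intro bounded_linear_axioms.intro f exI[of _ 1]) simp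
  then obtain F where F: "blinfun_apply F = f"
    using bounded_linear_Blinfun_apply by blast
  have "f x = norm x"
    using le[of "- x"] norm_deriv_minus_self[of x] linear_neg[OF f, of x] bound[of x] by simp
  moreover have "norm F = 1"
  proof (rule antisym)
    show "norm F \<le> 1"
      by (rule norm_blinfun_bound) (simp_all add: F bound)
    show "1 \<le> norm F"
      using norm_blinfun[of F x] \<open>f x = norm x\<close> \<open>x \<noteq> 0\<close> by (simp add: F)
  qed
  ultimately have "support_functional x F"
    by (simp add: support_functional_def F)
  with F show thesis by (auto intro: that)
qed

lemma ex_support_functional_attained:
  assumes "x \<noteq> 0"
  obtains F where "support_functional x F" and "blinfun_apply F y = norm_deriv x y"
proof -
  obtain f where f: "linear f" "\<And>z. f z \<le> norm_deriv x z" "f y = norm_deriv x y"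
    using hahn_banach_attained[OF sublinear_norm_deriv, of x y] by blast
  obtain F where "support_functional x F" "\<And>z. blinfun_apply F z = f z"
    using support_functionalI[OF assms f(1,2)] by blast
  with f(3) show thesis by (auto intro: that)
qed

text \<open>
  Support functionals take values between the left and the right derivative, so they are determined
  when the two agree. Otherwise functionals attaining the one and the other are different.
\<close>

lemma smooth_at_iff:
  fixes x :: "'a::real_normed_vector"
  assumes x: "x \<noteq> 0"
  shows "smooth_at x \<longleftrightarrow> (\<forall>y. norm_deriv x (- y) = - norm_deriv x y)"
proof
  assume smooth: "smooth_at x"
  show "\<forall>y. norm_deriv x (- y) = - norm_deriv x y"
  proof
    fix y
    obtain F where F: "support_functional x F" "blinfun_apply F y = norm_deriv x y"
      by (rule ex_support_functional_attained[OF x])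
    obtain G where G: "support_functional x G" "blinfun_apply G (- y) = norm_deriv x (- y)"
      by (rule ex_support_functional_attained[OF x])
    have "F = G"
      using smooth F(1) G(1) by (auto simp: smooth_at_def)
    with F(2) G(2) show "norm_deriv x (- y) = - norm_deriv x y"
      by (simp add: blinfun.minus_right)
  qed
next
  assume odd: "\<forall>y. norm_deriv x (- y) = - norm_deriv x y"
  have value_eq: "blinfun_apply F y = norm_deriv x y" if "support_functional x F" for F y
    using support_functional_le_norm_deriv[OF that, of y]
      support_functional_le_norm_deriv[OF that, of "- y"] odd by (simp add: blinfun.minus_right)
  show "smooth_at x"
    unfolding smooth_at_def
  proof (rule ex_ex1I)
    show "\<exists>F. support_functional x F"
      using ex_support_functional_attained[OF x] by blast
    show "F = G" if "support_functional x F" "support_functional x G" for F G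
      by (rule blinfun_eqI) (simp add: value_eq that)
  qed
qed

section \<open>Smoothness and equality of the orthogonality relations\<close>

lemma birkhoff_orth_eq_rho_orth_if_smooth:
  assumes "smooth_space TYPE('a::real_normed_vector)"
  shows "(birkhoff_orth :: ('a \<times> 'a) set) = rho_orth lam"
proof -
  have "(x, y) \<in> birkhoff_orth \<longleftrightarrow> rho lam x y = 0" for x y :: 'a
  proof (cases "x = 0")
    case True
    then show ?thesis by (simp add: birkhoff_orth_def rho_eq)
  next
    case False
    with assms have odd: "norm_deriv x (- y) = - norm_deriv x y"
      using smooth_at_iff[OF False] by (simp add: smooth_space_def)
    then have "rho lam x y = norm x * norm_deriv x y"
      by (simp add: rho_eq algebra_simps)
    with odd False show ?thesis
      by (auto simp: birkhoff_orth_iff)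
  qed
  then show ?thesis by (auto simp: rho_orth_def)
qed

text \<open>
  The directions \<open>y + a x\<close> and \<open>y + b x\<close> in the proof are those in which the left, respectively the
  right, derivative vanishes.
\<close>

lemma smooth_if_birkhoff_orth_subset_rho_orth:
  assumes sub: "(birkhoff_orth :: ('a::real_normed_vector \<times> 'a) set) \<subseteq> rho_orth lam"
  shows "smooth_space TYPE('a)"
  unfolding smooth_space_def
proof (intro allI impI)
  fix x :: 'a
  assume x: "x \<noteq> 0"
  have "norm_deriv x (- y) = - norm_deriv x y" for y
  proof -
    define a b where "a = norm_deriv x (- y) / norm x" and "b = - norm_deriv x y / norm x"
    define d where "d = norm_deriv x y + norm_deriv x (- y)"
    have d: "0 \<le> d"
      using sublinear_minus[OF sublinear_norm_deriv, of x y] by (simp add: d_def)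
    have shift: "norm_deriv x (- (y + c *\<^sub>R x)) = norm_deriv x (- y) - c * norm x" for c
      using norm_deriv_add_scaleR_self[of x "- y" "- c"] by simp
    have a: "norm_deriv x (y + a *\<^sub>R x) = d" "norm_deriv x (- (y + a *\<^sub>R x)) = 0"
      unfolding norm_deriv_add_scaleR_self shift using x by (simp_all add: a_def d_def)
    have b: "norm_deriv x (y + b *\<^sub>R x) = 0" "norm_deriv x (- (y + b *\<^sub>R x)) = d"
      unfolding norm_deriv_add_scaleR_self shift using x by (simp_all add: b_def d_def)
    have "(x, y + a *\<^sub>R x) \<in> rho_orth lam" "(x, y + b *\<^sub>R x) \<in> rho_orth lam"
      using sub d a b by (auto simp: birkhoff_orth_iff simp del: minus_add_distrib)
    then have "(1 - lam) * d = 0" "lam * d = 0"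
      using x a b by (auto simp: rho_orth_def rho_eq simp del: minus_add_distrib)
    then have "d = 0" by auto
    then show ?thesis by (simp add: d_def)
  qed
  with x show "smooth_at x" by (simp add: smooth_at_iff)
qed

theorem theorem2p7:
  fixes lam :: real
  assumes "dimension_ge_2 TYPE('a::real_normed_vector)"
    and "0 \<le> lam" and "lam \<le> 1"
  shows "((birkhoff_orth :: ('a \<times> 'a) set) \<subseteq> rho_orth lam
            \<longleftrightarrow> (birkhoff_orth :: ('a \<times> 'a) set) = rho_orth lam)
       \<and> ((birkhoff_orth :: ('a \<times> 'a) set) = rho_orth lam
            \<longleftrightarrow> smooth_space TYPE('a))"
  using birkhoff_orth_eq_rho_orth_if_smooth[where 'a = 'a]
    smooth_if_birkhoff_orth_subset_rho_orth[where 'a = 'a] by blast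

end
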